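(* Let $K$ be a finite weighted simplicial complex with its associated inner products on chain spaces. For any $p\ge 0$, let $\{\lambda_i(\mathcal{T}_p)\}$ be the eigenvalues (with multiplicities) of the effective resistance operator $\mathcal{T}_p$ on $C_p(K)$. Then $$\sum_i\lambda_i(\mathcal{T}_p)=\operatorname{rank}(\partial_p^{*})=n_{p-1}-\operatorname{null}(\partial_p^{*}).$$ Moreover, for any orthonormal basis $\{\alpha_i\}$ of $C_p(K)$, $$\sum_i\langle\mathcal{T}_p(\alpha_i),\alpha_i\rangle_{C_p}=\operatorname{rank}(\partial_p^{*})=n_{p-1}-\operatorname{null}(\partial_p^{*}).$$
   Context: $K$ is a finite simplicial complex with ordered vertices; $K_p$ is its set of $p$-simplices, $n_p=|K_p|$, with weights $w_p:K_p\to\mathbb{R}_{>0}$. $C_p(K)$ is the real vector space on the oriented $p$-simplices ($C_{-1}(K)=0$, $n_{-1}=0$), with boundary maps $\partial_p:C_p(K)\to C_{p-1}(K)$ and inner product $\langle\sigma,\tau\rangle_{C_p}=w_p(\sigma)^{-1}$ if $\sigma=\tau$, $0$ otherwise ($\sigma,\tau\in K_p$), extended bilinearly. $\partial_p^{*}$ is the adjoint of $\partial_p$, $\mathcal{L}^{\mathrm{up}}_{p-1}=\partial_p\partial_p^{*}$, and $^{+}$ is the Moore–Penrose pseudoinverse with respect to these inner products. The effective resistance operator on chains is $\mathcal{T}_p=\partial_p^{*}(\mathcal{L}^{\mathrm{up}}_{p-1})^{+}\partial_p=\partial_p^{*}(\partial_p^{*})^{+}$. $\operatorname{null}(\cdot)$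 denotes the dimension of the kernel. *)

theory Defs
  imports "HOL-Analysis.Analysis" "HOL-Analysis.Finite_Function_Topology"
begin

section \<open>Linear algebra on subspaces with explicit bilinear forms\<close>

text \<open>The chain spaces below carry weighted inner products that vary with the dimension, so they
  are subspaces of one real vector space, with the inner product an explicit argument, rather than
  instances of \<^class>\<open>real_inner\<close>.\<close>

definition adjoint_on ::
    "'a set \<Rightarrow> ('a \<Rightarrow> 'a \<Rightarrow> real) \<Rightarrow> ('b \<Rightarrow> 'b \<Rightarrow> real) \<Rightarrow> ('a \<Rightarrow> 'b) \<Rightarrow> 'b \<Rightarrow> 'a"
  where "adjoint_on V ipV ipW A y = (THE x. x \<in> V \<and> (\<forall>v\<in>V. ipW (A v) y = ipV v x))"

definition is_pinv_on ::
    "'a::real_vector set \<Rightarrow> ('a \<Rightarrow> 'a \<Rightarrow> real) \<Rightarrow> 'b::real_vector set \<Rightarrow> ('b \<Rightarrow> 'b \<Rightarrow> real)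
      \<Rightarrow> ('a \<Rightarrow> 'b) \<Rightarrow> ('b \<Rightarrow> 'a) \<Rightarrow> bool"
  where "is_pinv_on V ipV W ipW A G \<longleftrightarrow>
    (\<forall>y\<in>W. G y \<in> V) \<and>
    (\<forall>y\<in>W. \<forall>z\<in>W. G (y + z) = G y + G z) \<and> (\<forall>c. \<forall>y\<in>W. G (c *\<^sub>R y) = c *\<^sub>R G y) \<and>
    (\<forall>x\<in>V. A (G (A x)) = A x) \<and>
    (\<forall>y\<in>W. G (A (G y)) = G y) \<and>
    (\<forall>y\<in>W. \<forall>z\<in>W. ipW (A (G y)) z = ipW y (A (G z))) \<and>
    (\<forall>x\<in>V. \<forall>u\<in>V. ipV (G (A x)) u = ipV x (G (A u)))"

text \<open>The Penrose conditions determine the pseudoinverse only on \<open>W\<close>; it is set to \<open>0\<close> elsewhere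
  to make it a unique function.\<close>

definition pinv_on ::
    "'a::real_vector set \<Rightarrow> ('a \<Rightarrow> 'a \<Rightarrow> real) \<Rightarrow> 'b::real_vector set \<Rightarrow> ('b \<Rightarrow> 'b \<Rightarrow> real)
      \<Rightarrow> ('a \<Rightarrow> 'b) \<Rightarrow> 'b \<Rightarrow> 'a"
  where "pinv_on V ipV W ipW A =
    (THE G. is_pinv_on V ipV W ipW A G \<and> (\<forall>y. y \<notin> W \<longrightarrow> G y = 0))"

definition rank_on :: "'a set \<Rightarrow> ('a \<Rightarrow> 'b::real_vector) \<Rightarrow> nat"
  where "rank_on V A = dim (A ` V)"

definition null_on :: "'a::real_vector set \<Rightarrow> ('a \<Rightarrow> 'b::zero) \<Rightarrow> nat"
  where "null_on V A = dim {x \<in> V. A x = 0}"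

definition eigenvalues_on :: "'a::real_vector set \<Rightarrow> ('a \<Rightarrow> 'a) \<Rightarrow> real set"
  where "eigenvalues_on V A = {\<mu>. \<exists>x\<in>V. x \<noteq> 0 \<and> A x = \<mu> *\<^sub>R x}"

text \<open>Algebraic multiplicity, as the dimension of the generalized eigenspace.\<close>

definition multiplicity_on :: "'a::real_vector set \<Rightarrow> ('a \<Rightarrow> 'a) \<Rightarrow> real \<Rightarrow> nat"
  where "multiplicity_on V A \<mu> = dim {x \<in> V. \<exists>k. ((\<lambda>y. A y - \<mu> *\<^sub>R y) ^^ k) x = 0}"

definition orthonormal_basis_on ::
    "'a::real_vector set \<Rightarrow> ('a \<Rightarrow> 'a \<Rightarrow> real) \<Rightarrow> 'i set \<Rightarrow> ('i \<Rightarrow> 'a) \<Rightarrow> bool"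
  where "orthonormal_basis_on V ipV I \<alpha> \<longleftrightarrow>
    (\<forall>i\<in>I. \<alpha> i \<in> V) \<and>
    (\<forall>i\<in>I. \<forall>j\<in>I. ipV (\<alpha> i) (\<alpha> j) = (if i = j then 1 else 0)) \<and>
    span (\<alpha> ` I) = V"


section \<open>Weighted simplicial complexes and their chain spaces\<close>

definition finite_simplicial_complex :: "'v set set \<Rightarrow> bool"
  where "finite_simplicial_complex K \<longleftrightarrow>
    finite K \<and> (\<forall>\<sigma>\<in>K. finite \<sigma> \<and> \<sigma> \<noteq> {}) \<and> (\<forall>\<sigma>\<in>K. \<forall>\<tau>. \<tau> \<subseteq> \<sigma> \<and> \<tau> \<noteq> {} \<longrightarrow> \<tau> \<in> K)"

text \<open>The dimension \<open>p\<close> is an integer so that \<open>p - 1\<close> makes sense for \<open>p = 0\<close>. As the empty set is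
  not a simplex, there are no simplices of dimension \<open>-1\<close>.\<close>

definition simplices :: "'v set set \<Rightarrow> int \<Rightarrow> 'v set set"
  where "simplices K p = {\<sigma> \<in> K. int (card \<sigma>) = p + 1}"

text \<open>Each simplex, oriented by the order of its vertices, is a basis element of the chain space.\<close>

type_synonym 'v chain = "'v set \<Rightarrow>\<^sub>0 real"

definition chain_space :: "'v set set \<Rightarrow> int \<Rightarrow> 'v chain set"
  where "chain_space K p = {c. Poly_Mapping.keys c \<subseteq> simplices K p}"

text \<open>The sets of \<open>p\<close>-simplices are pairwise disjoint, so the weights \<open>w\<^sub>p\<close> form a single
  function \<open>w\<close>.\<close>

definition chain_inner :: "'v set set \<Rightarrow> ('v set \<Rightarrow> real) \<Rightarrow> int \<Rightarrow> 'v chain \<Rightarrow> 'v chain \<Rightarrow> real"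
  where "chain_inner K w p c d =
    (\<Sum>\<sigma>\<in>simplices K p. Poly_Mapping.lookup c \<sigma> * Poly_Mapping.lookup d \<sigma> * inverse (w \<sigma>))"

definition simplex_boundary :: "'v::linorder set \<Rightarrow> 'v chain"
  where "simplex_boundary \<sigma> =
    (\<Sum>i<card \<sigma>. Poly_Mapping.single (\<sigma> - {sorted_list_of_set \<sigma> ! i}) ((-1) ^ i))"

text \<open>The boundary map vanishes for \<open>p = 0\<close>: the complex is not augmented.\<close>

definition boundary_map :: "'v::linorder set set \<Rightarrow> int \<Rightarrow> 'v chain \<Rightarrow> 'v chain"
  where "boundary_map K p c =
    (if p \<le> 0 then 0 else \<Sum>\<sigma>\<in>simplices K p. Poly_Mapping.lookup c \<sigma> *\<^sub>R simplex_boundary \<sigma>)"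

definition boundary_adj ::
    "'v::linorder set set \<Rightarrow> ('v set \<Rightarrow> real) \<Rightarrow> int \<Rightarrow> 'v chain \<Rightarrow> 'v chain"
  where "boundary_adj K w p =
    adjoint_on (chain_space K p) (chain_inner K w p) (chain_inner K w (p - 1)) (boundary_map K p)"

definition up_laplacian ::
    "'v::linorder set set \<Rightarrow> ('v set \<Rightarrow> real) \<Rightarrow> int \<Rightarrow> 'v chain \<Rightarrow> 'v chain"
  where "up_laplacian K w q = boundary_map K (q + 1) \<circ> boundary_adj K w (q + 1)"

definition effective_resistance ::
    "'v::linorder set set \<Rightarrow> ('v set \<Rightarrow> real) \<Rightarrow> int \<Rightarrow> 'v chain \<Rightarrow> 'v chain"
  where "effective_resistance K w p =
    boundary_adj K w p \<circ>
    pinv_on (chain_space K (p - 1)) (chain_inner K w (p - 1))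
            (chain_space K (p - 1)) (chain_inner K w (p - 1)) (up_laplacian K w (p - 1)) \<circ>
    boundary_map K p"

end

theory Submission
  imports Defs
begin

text \<open>Write \<open>d\<close> for the boundary map out of \<open>C\<^sub>p\<close>, \<open>d*\<close> for its adjoint and \<open>T = d* (d d*)\<^sup>+ d\<close>.
  The theorem holds because \<open>T\<close> is the orthogonal projection of \<open>C\<^sub>p\<close> onto the range of \<open>d*\<close>
  (\<open>resistance_projection\<close>). Certainly \<open>T x\<close> lies in that range. By the least-squares property of
  the pseudoinverse, \<open>d (x - T x)\<close> is orthogonal to the range of \<open>d d*\<close>; but it also lies in the
  range of \<open>d\<close>, and a vector \<open>u = d r\<close> orthogonal to \<open>d d* u\<close> has \<open>d* u = 0\<close> and hence \<open>u = 0\<close>.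
  So \<open>x - T x\<close> lies in the kernel of \<open>d\<close>, the orthogonal complement of the range of \<open>d*\<close>.

  An orthogonal projection onto \<open>S\<close> has no eigenvalues besides \<open>0\<close> and \<open>1\<close>, and the generalized
  eigenspace of \<open>1\<close> is \<open>S\<close>, so its eigenvalues add up to \<open>dim S\<close>. Its trace in any orthonormal
  basis of the ambient space is \<open>dim S\<close> as well, by expanding the projection in an orthonormal
  basis of \<open>S\<close> and exchanging the two sums. With \<open>S\<close> the range of \<open>d*\<close>, both numbers are the rank
  of \<open>d*\<close>, and rank-nullity for \<open>d*\<close> gives the second expression.

  All of this is linear algebra in finite-dimensional subspaces with their own inner products; chain
  spaces enter only at the end, as instances of \<open>inner_subspace_map\<close>.\<close>

section \<open>Finite-dimensional subspaces with an inner product\<close>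

text \<open>The form is bilinear and symmetric on the whole type but positive definite only on \<open>V\<close>, as
  is the case for the inner product of chains, which sees only the simplices of one dimension.
  Thanks to the global bilinearity, adjoints are linear on the whole type too, so that library
  lemmas about \<^const>\<open>linear\<close> maps apply to them.\<close>

locale inner_subspace =
  fixes V :: "'a::real_vector set" and ip :: "'a \<Rightarrow> 'a \<Rightarrow> real"
  assumes subspace_V: "subspace V"
    and finite_dim: "\<exists>B. finite B \<and> V \<subseteq> span B"
    and bilinear: "bilinear ip"
    and ip_commute: "ip x y = ip y x"
    and nonneg: "x \<in> V \<Longrightarrow> 0 \<le> ip x x"
    and definite: "x \<in> V \<Longrightarrow> ip x x = 0 \<Longrightarrow> x = 0"
begin

lemmas ip_simps =
  bilinear_ladd[OF bilinear] bilinear_radd[OF bilinear]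
  bilinear_lsub[OF bilinear] bilinear_rsub[OF bilinear]
  bilinear_lmul[OF bilinear] bilinear_rmul[OF bilinear]
  bilinear_lzero[OF bilinear] bilinear_rzero[OF bilinear]

lemma ip_sum_left: "ip (\<Sum>i\<in>I. f i) y = (\<Sum>i\<in>I. ip (f i) y)"
proof -
  interpret linear "\<lambda>x. ip x y" using bilinear by (simp add: bilinear_def)
  show ?thesis by (rule sum)
qed

lemma ip_sum_right: "ip y (\<Sum>i\<in>I. f i) = (\<Sum>i\<in>I. ip y (f i))"
  by (simp add: ip_commute[of y] ip_sum_left)

lemmas V_closed = subspace_add[OF subspace_V] subspace_diff[OF subspace_V]
  subspace_scale[OF subspace_V] subspace_sum[OF subspace_V] subspace_0[OF subspace_V]

lemma eqI_ip:
  assumes "x \<in> V" "y \<in> V" and "\<And>v. v \<in> V \<Longrightarrow> ip x v = ip y v"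
  shows "x = y"
proof -
  have "x - y \<in> V" using assms V_closed by blast
  then show ?thesis using definite[of "x - y"] assms by (simp add: ip_simps)
qed

lemma orthogonal_span:
  assumes "y \<in> span S" and "\<And>s. s \<in> S \<Longrightarrow> ip r s = 0"
  shows "ip r y = 0"
  using assms by (induction rule: span_induct_alt) (auto simp: ip_simps)

text \<open>The index set of an orthonormal basis need not be finite by definition; that it is follows
  from injectivity and independence of the family, in a finite-dimensional space.\<close>

lemma orthonormal_basis_inj:
  assumes "orthonormal_basis_on V ip I \<alpha>"
  shows "inj_on \<alpha> I"
proof (rule inj_onI)
  fix i j assume "i \<in> I" "j \<in> I" "\<alpha> i = \<alpha> j"
  then have "ip (\<alpha> i) (\<alpha> j) = 1" "ip (\<alpha> i) (\<alpha> j) = (if i = j then 1 else 0)"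
    using assms unfolding orthonormal_basis_on_def by metis+
  then show "i = j" by (simp split: if_splits)
qed

lemma orthonormal_basis_independent:
  assumes "orthonormal_basis_on V ip I \<alpha>"
  shows "independent (\<alpha> ` I)"
proof
  assume "dependent (\<alpha> ` I)"
  then obtain i where i: "i \<in> I" and "\<alpha> i \<in> span (\<alpha> ` I - {\<alpha> i})"
    unfolding dependent_def by blast
  then have "ip (\<alpha> i) (\<alpha> i) = 0"
    using i assms unfolding orthonormal_basis_on_def by (elim orthogonal_span) auto
  with i assms show False unfolding orthonormal_basis_on_def by simp
qed

lemma orthonormal_basis_finite:
  assumes "orthonormal_basis_on V ip I \<alpha>"
  shows "finite I"
proof -
  obtain B where "finite B" "V \<subseteq> span B" using finite_dim by blast
  moreover have "\<alpha> ` I \<subseteq> V" using assms by (auto simp: orthonormal_basis_on_def)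
  ultimately have "finite (\<alpha> ` I)"
    using independent_span_bound[OF _ orthonormal_basis_independent[OF assms]] by blast
  then show ?thesis using orthonormal_basis_inj[OF assms] by (rule finite_imageD)
qed

lemma orthonormal_basis_card:
  assumes "orthonormal_basis_on V ip I \<alpha>"
  shows "card I = dim V"
proof -
  have "dim V = card (\<alpha> ` I)"
    using assms dim_span_eq_card_independent[OF orthonormal_basis_independent[OF assms]]
    by (simp add: orthonormal_basis_on_def)
  then show ?thesis by (simp add: card_image orthonormal_basis_inj[OF assms])
qed

text \<open>The difference of \<open>x\<close> and its expansion is orthogonal to the basis, hence to all of \<open>V\<close>,
  itself included.\<close>

lemma orthonormal_basis_expansion:
  assumes onb: "orthonormal_basis_on V ip I \<alpha>" and x: "x \<in> V"
  shows "x = (\<Sum>i\<in>I. ip x (\<alpha> i) *\<^sub>R \<alpha> i)"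
proof -
  have fin: "finite I" by (rule orthonormal_basis_finite[OF onb])
  define r where "r = x - (\<Sum>i\<in>I. ip x (\<alpha> i) *\<^sub>R \<alpha> i)"
  have r: "r \<in> V"
    unfolding r_def using x onb by (intro V_closed) (auto simp: orthonormal_basis_on_def)
  have "ip r (\<alpha> j) = 0" if j: "j \<in> I" for j
  proof -
    have "ip (\<Sum>i\<in>I. ip x (\<alpha> i) *\<^sub>R \<alpha> i) (\<alpha> j) = (\<Sum>i\<in>I. if i = j then ip x (\<alpha> i) else 0)"
      unfolding ip_sum_left using onb j
      by (intro sum.cong) (auto simp: ip_simps orthonormal_basis_on_def)
    then show ?thesis using fin j by (simp add: r_def ip_simps)
  qed
  then have "ip r y = 0" if "y \<in> V" for y
    using orthogonal_span[of y "\<alpha> ` I" r] that onb by (auto simp: orthonormal_basis_on_def)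
  with r have "r = 0" using definite by blast
  then show ?thesis by (simp add: r_def)
qed

lemma parseval:
  assumes "orthonormal_basis_on V ip I \<alpha>" and "x \<in> V"
  shows "(\<Sum>i\<in>I. (ip x (\<alpha> i))\<^sup>2) = ip x x"
proof -
  have "ip x x = ip x (\<Sum>i\<in>I. ip x (\<alpha> i) *\<^sub>R \<alpha> i)"
    using orthonormal_basis_expansion[OF assms] by simp
  also have "\<dots> = (\<Sum>i\<in>I. (ip x (\<alpha> i))\<^sup>2)"
    by (simp add: ip_sum_right ip_simps power2_eq_square)
  finally show ?thesis by simp
qed

text \<open>One Gram-Schmidt step: subtract from the new vector \<open>a\<close> its projection \<open>q\<close> onto the old span.
  The residue \<open>r\<close> either vanishes, and then \<open>a\<close> adds nothing to the span, or is normalized.\<close>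

lemma gram_schmidt:
  assumes "finite C" "C \<subseteq> V"
  shows "\<exists>B. orthonormal_basis_on (span C) ip B (\<lambda>x. x)"
  using assms
proof (induction rule: finite_induct)
  case empty
  have "orthonormal_basis_on (span {}) ip {} (\<lambda>x. x)" by (simp add: orthonormal_basis_on_def)
  then show ?case by blast
next
  case (insert a C)
  then obtain B where B: "orthonormal_basis_on (span C) ip B (\<lambda>x. x)" by auto
  have CV: "span C \<subseteq> V" using insert.prems subspace_V by (simp add: span_minimal)
  interpret C: inner_subspace "span C" ip
    using insert.hyps CV by unfold_locales (auto simp: bilinear ip_commute nonneg definite)
  have finB: "finite B" using C.orthonormal_basis_finite[OF B] .
  have BV: "B \<subseteq> span C" and spB: "span B = span C"
    and orth: "\<And>x y. x \<in> B \<Longrightarrow> y \<in> B \<Longrightarrow> ip x y = (if x = y then 1 else 0)"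
    using B by (auto simp: orthonormal_basis_on_def)
  define q where "q = (\<Sum>b\<in>B. ip a b *\<^sub>R b)"
  define r where "r = a - q"
  have q: "q \<in> span C" unfolding q_def using BV by (intro span_sum span_scale) auto
  have r: "r \<in> V" unfolding r_def using insert.prems q CV V_closed by auto
  have rB: "ip r c = 0" if c: "c \<in> B" for c
  proof -
    have "ip q c = (\<Sum>b\<in>B. if b = c then ip a b else 0)"
      unfolding q_def ip_sum_left using c orth by (intro sum.cong) (auto simp: ip_simps)
    then show ?thesis using finB c by (simp add: r_def ip_simps)
  qed
  show ?case
  proof (cases "r = 0")
    case True
    then have "span (insert a C) = span C" using q by (simp add: r_def span_redundant)
    then show ?thesis using B by auto
  next
    case False
    then have pos: "0 < ip r r" using nonneg[OF r] definite[OF r] by force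
    define n where "n = inverse (sqrt (ip r r))"
    have n: "n \<noteq> 0" "n * n * ip r r = 1"
      using pos by (simp_all add: n_def field_simps)
    have nn: "ip (n *\<^sub>R r) (n *\<^sub>R r) = 1" using n by (simp add: ip_simps)
    have nB: "ip (n *\<^sub>R r) c = 0" "ip c (n *\<^sub>R r) = 0" if "c \<in> B" for c
      using rB[OF that] ip_commute[of c "n *\<^sub>R r"] by (simp_all add: ip_simps)
    have "span (insert (n *\<^sub>R r) B) = span (insert a C)"
    proof (rule subset_antisym)
      have "B \<subseteq> span (insert a C)" using BV span_mono[of C "insert a C"] by blast
      moreover have "r \<in> span (insert a C)"
        unfolding r_def using q span_mono[of C "insert a C"]
        by (intro span_diff) (auto intro: span_base)
      ultimately show "span (insert (n *\<^sub>R r) B) \<subseteq> span (insert a C)"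
        by (intro span_minimal) (auto intro: span_scale)
      have C': "span C \<subseteq> span (insert (n *\<^sub>R r) B)"
        unfolding spB[symmetric] by (rule span_mono) auto
      have "inverse n *\<^sub>R (n *\<^sub>R r) \<in> span (insert (n *\<^sub>R r) B)"
        by (intro span_scale span_base) simp
      then have "r \<in> span (insert (n *\<^sub>R r) B)" using n by simp
      then have "r + q \<in> span (insert (n *\<^sub>R r) B)" using q C' by (intro span_add) auto
      then show "span (insert a C) \<subseteq> span (insert (n *\<^sub>R r) B)"
        using C' span_superset[of C] by (intro span_minimal) (auto simp: r_def)
    qed
    moreover have "n *\<^sub>R r \<notin> B" using nn nB by auto
    ultimately have "orthonormal_basis_on (span (insert a C)) ip (insert (n *\<^sub>R r) B) (\<lambda>x. x)"
      unfolding orthonormal_basis_on_def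
      using nn nB orth span_superset[of "insert (n *\<^sub>R r) B"] \<open>n *\<^sub>R r \<notin> B\<close> by auto
    then show ?thesis by blast
  qed
qed

lemma orthonormal_basis_exists:
  obtains B where "orthonormal_basis_on V ip B (\<lambda>x. x)"
proof -
  obtain C where C: "C \<subseteq> V" "independent C" "V \<subseteq> span C"
    using maximal_independent_subset[of V] by blast
  obtain D where "finite D" "V \<subseteq> span D" using finite_dim by blast
  then have "finite C" using C independent_span_bound by blast
  moreover have "span C = V" using C subspace_V span_subspace by blast
  ultimately show ?thesis using gram_schmidt[of C] C that by auto
qed

lemma restrict:
  assumes "subspace S" "S \<subseteq> V"
  shows "inner_subspace S ip"
  using assms finite_dim
  by unfold_locales (auto simp: bilinear ip_commute nonneg definite)

text \<open>The Riesz representation of a functional, which yields both adjoints and orthogonal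
  projections below.\<close>

lemma riesz:
  assumes "linear f"
  shows "\<exists>!x. x \<in> V \<and> (\<forall>v\<in>V. f v = ip v x)"
proof -
  obtain B where B: "orthonormal_basis_on V ip B (\<lambda>x. x)" by (rule orthonormal_basis_exists)
  let ?x = "\<Sum>b\<in>B. f b *\<^sub>R b"
  have "f v = ip v ?x" if "v \<in> V" for v
  proof -
    have "f v = f (\<Sum>b\<in>B. ip v b *\<^sub>R b)" using orthonormal_basis_expansion[OF B that] by simp
    also have "\<dots> = ip v ?x"
      using assms by (simp add: ip_sum_right ip_simps linear_sum linear_cmul mult.commute)
    finally show ?thesis .
  qed
  moreover have "?x \<in> V" using B by (intro V_closed) (auto simp: orthonormal_basis_on_def)
  ultimately have "?x \<in> V \<and> (\<forall>v\<in>V. f v = ip v ?x)" by blast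
  moreover have "x = y" if "x \<in> V \<and> (\<forall>v\<in>V. f v = ip v x)" "y \<in> V \<and> (\<forall>v\<in>V. f v = ip v y)" for x y
    using that by (intro eqI_ip) (metis ip_commute)+
  ultimately show ?thesis by blast
qed

section \<open>Trace and eigenvalues of orthogonal projections\<close>

definition orthogonal_projection :: "'a set \<Rightarrow> ('a \<Rightarrow> 'a) \<Rightarrow> bool"
  where "orthogonal_projection S P \<longleftrightarrow> (\<forall>x\<in>V. P x \<in> S \<and> (\<forall>s\<in>S. ip (x - P x) s = 0))"

text \<open>The projection of \<open>x\<close> onto \<open>S\<close> is the vector of \<open>S\<close> that represents the functional
  \<open>\<langle>_, x\<rangle>\<close> on \<open>S\<close>.\<close>

lemma orthogonal_projection_exists:
  assumes "subspace S" "S \<subseteq> V"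
  obtains P where "orthogonal_projection S P"
proof -
  interpret S: inner_subspace S ip using assms by (rule restrict)
  have ex: "\<exists>!p. p \<in> S \<and> (\<forall>s\<in>S. ip s x = ip s p)" for x
    using S.riesz[of "\<lambda>s. ip s x"] bilinear by (simp add: bilinear_def)
  define P where "P x = (THE p. p \<in> S \<and> (\<forall>s\<in>S. ip s x = ip s p))" for x
  have P: "P x \<in> S \<and> (\<forall>s\<in>S. ip s x = ip s (P x))" for x
    unfolding P_def by (rule theI'[OF ex])
  have "ip (x - P x) s = 0" if "s \<in> S" for x s
  proof -
    have "ip s x = ip s (P x)" using P that by blast
    then have "ip s (x - P x) = 0" by (simp only: ip_simps)
    then show ?thesis by (simp only: ip_commute[of s])
  qed
  then have "orthogonal_projection S P"
    using P unfolding orthogonal_projection_def by blast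
  then show ?thesis by (rule that)
qed

lemma orthogonal_projection_id:
  assumes "subspace S" "S \<subseteq> V" "orthogonal_projection S P" "x \<in> S"
  shows "P x = x"
proof -
  interpret S: inner_subspace S ip using assms(1,2) by (rule restrict)
  have "P x \<in> S" "\<And>s. s \<in> S \<Longrightarrow> ip (x - P x) s = 0"
    using assms by (auto simp: orthogonal_projection_def)
  then show ?thesis using S.eqI_ip[of x "P x"] assms by (simp add: ip_simps)
qed

text \<open>With an orthonormal basis \<open>B\<close> of \<open>S\<close>, \<open>\<langle>P x, x\<rangle>\<close> is the sum of the \<open>\<langle>b, x\<rangle>\<^sup>2\<close> over \<open>B\<close>. Summing
  over \<open>x = \<alpha> i\<close> and exchanging the sums, Parseval's identity for \<open>\<alpha>\<close> makes every \<open>b\<close> contribute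
  \<open>\<langle>b, b\<rangle> = 1\<close>.\<close>

lemma orthogonal_projection_trace:
  assumes S: "subspace S" "S \<subseteq> V" and P: "orthogonal_projection S P"
    and \<alpha>: "orthonormal_basis_on V ip I \<alpha>"
  shows "(\<Sum>i\<in>I. ip (P (\<alpha> i)) (\<alpha> i)) = real (dim S)"
proof -
  interpret S: inner_subspace S ip using S by (rule restrict)
  obtain B where B: "orthonormal_basis_on S ip B (\<lambda>x. x)" by (rule S.orthonormal_basis_exists)
  have BS: "B \<subseteq> S" and unit: "\<And>b. b \<in> B \<Longrightarrow> ip b b = 1"
    using B by (auto simp: orthonormal_basis_on_def)
  have "ip (P x) x = (\<Sum>b\<in>B. (ip b x)\<^sup>2)" if x: "x \<in> V" for x
  proof -
    have Px: "P x \<in> S" and orth: "\<And>s. s \<in> S \<Longrightarrow> ip x s = ip (P x) s"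
      using P x by (auto simp: orthogonal_projection_def ip_simps)
    have "ip (P x) x = ip (P x) (P x)" using orth[OF Px] ip_commute[of x "P x"] by simp
    also have "\<dots> = (\<Sum>b\<in>B. (ip (P x) b)\<^sup>2)" using S.parseval[OF B Px] by simp
    also have "\<dots> = (\<Sum>b\<in>B. (ip b x)\<^sup>2)"
      using BS orth ip_commute[of x] by (intro sum.cong) auto
    finally show ?thesis .
  qed
  then have "(\<Sum>i\<in>I. ip (P (\<alpha> i)) (\<alpha> i)) = (\<Sum>i\<in>I. \<Sum>b\<in>B. (ip b (\<alpha> i))\<^sup>2)"
    using \<alpha> by (intro sum.cong) (auto simp: orthonormal_basis_on_def)
  also have "\<dots> = (\<Sum>b\<in>B. \<Sum>i\<in>I. (ip b (\<alpha> i))\<^sup>2)" by (rule sum.swap)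
  also have "\<dots> = (\<Sum>b\<in>B. 1)"
    using BS S unit parseval[OF \<alpha>] by (intro sum.cong) auto
  finally show ?thesis using S.orthonormal_basis_card[OF B] by simp
qed

lemma subspace_complement: "subspace {x \<in> V. \<forall>s\<in>S. ip x s = 0}"
  using V_closed by (auto simp: subspace_def ip_simps)

text \<open>Take traces in \<open>1 = P + (1 - P)\<close>, where \<open>1 - P\<close> projects onto the complement.\<close>

lemma dim_complement:
  assumes S: "subspace S" "S \<subseteq> V"
  shows "dim S + dim {x \<in> V. \<forall>s\<in>S. ip x s = 0} = dim V"
proof -
  let ?N = "{x \<in> V. \<forall>s\<in>S. ip x s = 0}"
  obtain P where P: "orthogonal_projection S P" using orthogonal_projection_exists[OF S] .
  obtain B where B: "orthonormal_basis_on V ip B (\<lambda>x. x)" by (rule orthonormal_basis_exists)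
  have "orthogonal_projection ?N (\<lambda>x. x - P x)"
    unfolding orthogonal_projection_def
  proof (intro ballI conjI)
    fix x assume x: "x \<in> V"
    then have Px: "P x \<in> S" "\<forall>s\<in>S. ip (x - P x) s = 0"
      using P by (auto simp: orthogonal_projection_def)
    then show "x - P x \<in> ?N" using x S V_closed by auto
    show "ip (x - (x - P x)) n = 0" if "n \<in> ?N" for n
      using that Px ip_commute[of n "P x"] by simp
  qed
  then have "(\<Sum>b\<in>B. ip (b - P b) b) = real (dim ?N)"
    using orthogonal_projection_trace[OF subspace_complement _ _ B] by blast
  moreover have "(\<Sum>b\<in>B. ip (P b) b) = real (dim S)"
    using orthogonal_projection_trace[OF S P B] .
  moreover have "(\<Sum>b\<in>B. ip (b - P b) b) = real (dim V) - (\<Sum>b\<in>B. ip (P b) b)"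
    using B orthonormal_basis_card[OF B]
    by (simp add: ip_simps sum_subtractf orthonormal_basis_on_def)
  ultimately show ?thesis by linarith
qed

lemma subspace_kernel: "linear A \<Longrightarrow> subspace {x \<in> V. A x = 0}"
  using V_closed by (auto simp: subspace_def linear_add linear_cmul linear_0)

text \<open>The ambient type may be infinite-dimensional, since only \<open>V\<close> is assumed finite-dimensional.
  The map \<open>A\<close> takes the orthogonal complement of its kernel bijectively onto its range.\<close>

lemma rank_nullity:
  fixes A :: "'a \<Rightarrow> 'b::real_vector"
  assumes A: "linear A"
  shows "rank_on V A + null_on V A = dim V"
proof -
  let ?K = "{x \<in> V. A x = 0}"
  let ?N = "{x \<in> V. \<forall>s\<in>?K. ip x s = 0}"
  have K: "subspace ?K" "?K \<subseteq> V" using subspace_kernel[OF A] by auto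
  obtain P where P: "orthogonal_projection ?K P" using orthogonal_projection_exists[OF K] .
  have inj: "inj_on A ?N"
    unfolding linear_inj_on_iff_eq_0[OF A subspace_complement] using definite by blast
  obtain C where C: "C \<subseteq> ?N" "independent C" "?N \<subseteq> span C" "card C = dim ?N"
    using basis_exists[of ?N] by blast
  then have spC: "span C = ?N" using span_subspace subspace_complement by blast
  have "A ` ?N = A ` V"
  proof (intro subset_antisym subsetI)
    fix y assume "y \<in> A ` V"
    then obtain x where x: "x \<in> V" "y = A x" by blast
    then have "P x \<in> ?K" "x - P x \<in> ?N"
      using P V_closed by (auto simp: orthogonal_projection_def)
    moreover have "A (x - P x) = y" using x calculation A by (simp add: linear_diff)
    ultimately show "y \<in> A ` ?N" by blast
  qed auto
  then have "span (A ` C) = A ` V" using spC by (simp add: linear_span_image[OF A])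
  moreover have "independent (A ` C)"
    using linear_independent_injective_image[OF A C(2)] inj spC by simp
  moreover have "card (A ` C) = card C" using inj C(1) card_image inj_on_subset by blast
  ultimately have "dim (A ` V) = dim ?N" using C(4) dim_span_eq_card_independent by metis
  then show ?thesis using dim_complement[OF K] by (simp add: rank_on_def null_on_def)
qed

lemma orthogonal_projection_eq_0:
  assumes S: "subspace S" "S \<subseteq> V" and P: "orthogonal_projection S P"
    and y: "y \<in> V" "\<forall>s\<in>S. ip y s = 0"
  shows "P y = 0"
proof -
  have Py: "P y \<in> S" and "\<And>s. s \<in> S \<Longrightarrow> ip (P y) s = 0"
    using P y by (auto simp: orthogonal_projection_def ip_simps)
  then show ?thesis using definite[of "P y"] S by blast
qed

text \<open>After one application of \<open>P - 1\<close> a vector is orthogonal to \<open>S\<close>, and there \<open>P - 1\<close> is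
  \<open>-1\<close>; so powers of \<open>P - 1\<close> kill nothing that \<open>P - 1\<close> does not kill already.\<close>

lemma orthogonal_projection_generalized_eigenspace:
  assumes S: "subspace S" "S \<subseteq> V" and P: "orthogonal_projection S P"
  shows "{x \<in> V. \<exists>k. ((\<lambda>y. P y - 1 *\<^sub>R y) ^^ k) x = 0} = S"
proof (intro subset_antisym subsetI)
  let ?Q = "\<lambda>y. P y - 1 *\<^sub>R y"
  have pow: "(?Q ^^ k) y = 0 \<Longrightarrow> y = 0" if "y \<in> V" "\<forall>s\<in>S. ip y s = 0" for y k
    using that
  proof (induction k arbitrary: y)
    case (Suc k)
    have neg: "?Q y = - y" using orthogonal_projection_eq_0[OF S P Suc.prems(2,3)] by simp
    have "- y \<in> V" "\<forall>s\<in>S. ip (- y) s = 0"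
      using Suc.prems V_closed(3)[of y "-1"] bilinear_lneg[OF bilinear] by auto
    moreover have "(?Q ^^ k) (- y) = 0"
      using Suc.prems(1) neg by (simp add: funpow_Suc_right del: funpow.simps)
    ultimately have "- y = 0" using Suc.IH by blast
    then show ?case by simp
  qed simp
  fix x assume "x \<in> {x \<in> V. \<exists>k. (?Q ^^ k) x = 0}"
  then obtain k where x: "x \<in> V" and k: "(?Q ^^ k) x = 0" by blast
  have Px: "P x \<in> S" using P x by (simp add: orthogonal_projection_def)
  have Qx: "?Q x \<in> V" "\<forall>s\<in>S. ip (?Q x) s = 0"
    using P x S V_closed by (auto simp: orthogonal_projection_def ip_simps)
  show "x \<in> S"
  proof (cases k)
    case 0
    then show ?thesis using k S subspace_0 by auto
  next
    case (Suc j)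
    then have "(?Q ^^ j) (?Q x) = 0" using k by (simp add: funpow_Suc_right del: funpow.simps)
    then have "P x = x" using pow[OF Qx] by simp
    then show ?thesis using Px by simp
  qed
next
  fix x assume x: "x \<in> S"
  then have "((\<lambda>y. P y - 1 *\<^sub>R y) ^^ 1) x = 0" using orthogonal_projection_id[OF S P] by simp
  then show "x \<in> {x \<in> V. \<exists>k. ((\<lambda>y. P y - 1 *\<^sub>R y) ^^ k) x = 0}" using x S by blast
qed

lemma orthogonal_projection_eigenvalues:
  assumes S: "subspace S" "S \<subseteq> V" and P: "orthogonal_projection S P"
  shows "eigenvalues_on V P \<subseteq> {0, 1}"
proof
  fix \<mu> assume "\<mu> \<in> eigenvalues_on V P"
  then obtain x where x: "x \<in> V" "x \<noteq> 0" "P x = \<mu> *\<^sub>R x" by (auto simp: eigenvalues_on_def)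
  show "\<mu> \<in> {0, 1}"
  proof (cases "\<mu> = 0")
    case False
    have "P x \<in> S" using P x(1) unfolding orthogonal_projection_def by blast
    then have "inverse \<mu> *\<^sub>R P x \<in> S" by (rule subspace_scale[OF S(1)])
    then have "x \<in> S" using x False by simp
    then have "\<mu> *\<^sub>R x = 1 *\<^sub>R x" using orthogonal_projection_id[OF S P] x by simp
    then have "\<mu> = 1" by (rule scaleR_right_imp_eq[OF x(2)])
    then show ?thesis by simp
  qed simp
qed

lemma orthogonal_projection_eigenvalues_sum:
  assumes S: "subspace S" "S \<subseteq> V" and P: "orthogonal_projection S P"
  shows "(\<Sum>\<mu>\<in>eigenvalues_on V P. real (multiplicity_on V P \<mu>) * \<mu>) = real (dim S)"
proof -
  note ev = orthogonal_projection_eigenvalues[OF assms]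
  have fin: "finite (eigenvalues_on V P)" using ev by (rule finite_subset) simp
  have mult: "multiplicity_on V P 1 = dim S"
    unfolding multiplicity_on_def orthogonal_projection_generalized_eigenspace[OF assms] ..
  have "(\<Sum>\<mu>\<in>eigenvalues_on V P. real (multiplicity_on V P \<mu>) * \<mu>)
      = (\<Sum>\<mu>\<in>eigenvalues_on V P. if \<mu> = 1 then real (dim S) else 0)"
    using ev mult by (intro sum.cong) auto
  also have "\<dots> = real (dim S)"
  proof (cases "S = {0}")
    case True
    have "dim {0 :: 'a} = 0"
      using dim_span[of "{} :: 'a set"] dim_eq_card_independent[OF independent_empty, where ?'a = 'a]
      by (simp del: dim_span)
    then show ?thesis using True fin by simp
  next
    case False
    then have "1 \<in> eigenvalues_on V P"
      using orthogonal_projection_id[OF S P] S subspace_0[OF S(1)]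
      by (auto simp: eigenvalues_on_def)
    then show ?thesis using fin by simp
  qed
  finally show ?thesis .
qed

end

section \<open>Adjoint and Moore-Penrose pseudoinverse\<close>

locale inner_subspace_map = V: inner_subspace V ipV + W: inner_subspace W ipW
  for V :: "'a::real_vector set" and ipV and W :: "'b::real_vector set" and ipW +
  fixes A :: "'a \<Rightarrow> 'b"
  assumes linear_A: "linear A" and maps: "A ` V \<subseteq> W"
begin

abbreviation adj :: "'b \<Rightarrow> 'a"
  where "adj \<equiv> adjoint_on V ipV ipW A"

lemma adj: "adj y \<in> V \<and> (\<forall>v\<in>V. ipW (A v) y = ipV v (adj y))"
proof -
  have "linear (\<lambda>v. ipW (A v) y)"
    using linear_compose[OF linear_A, of "\<lambda>z. ipW z y"] W.bilinear by (simp add: bilinear_def o_def)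
  from theI'[OF V.riesz[OF this]] show ?thesis unfolding adjoint_on_def .
qed

lemma adj_in: "adj y \<in> V"
  using adj by blast

lemma ip_adj: "v \<in> V \<Longrightarrow> ipV v (adj y) = ipW (A v) y"
  using adj[of y] by simp

lemma adj_ip: "v \<in> V \<Longrightarrow> ipV (adj y) v = ipW y (A v)"
  using ip_adj[of v y] V.ip_commute[of v] W.ip_commute[of "A v"] by simp

lemma linear_adj: "linear adj"
proof (rule linearI)
  show "adj (y + z) = adj y + adj z" for y z
    by (rule V.eqI_ip) (auto simp: adj_in adj_ip V.ip_simps W.ip_simps intro: V.V_closed)
  show "adj (c *\<^sub>R y) = c *\<^sub>R adj y" for c y
    by (rule V.eqI_ip) (auto simp: adj_in adj_ip V.ip_simps W.ip_simps intro: V.V_closed)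
qed

lemma subspace_range: "subspace (A ` V)"
  using linear_subspace_image[OF linear_A V.subspace_V] .

text \<open>The normal equations: the residual \<open>y - A x\<close> is orthogonal to the range of \<open>A\<close>, and \<open>x\<close> has
  minimal norm among such vectors, being orthogonal to the kernel. The four Penrose conditions
  on \<open>G\<close> say exactly that \<open>G y\<close> is the solution for every \<open>y\<close>; existence and uniqueness of the
  pseudoinverse thus reduce to those of the least-squares solution.\<close>

definition least_squares :: "'b \<Rightarrow> 'a \<Rightarrow> bool"
  where "least_squares y x \<longleftrightarrow>
    x \<in> V \<and> (\<forall>k\<in>V. A k = 0 \<longrightarrow> ipV x k = 0) \<and> (\<forall>v\<in>V. ipW (y - A x) (A v) = 0)"

text \<open>Project \<open>y\<close> onto the range of \<open>A\<close>, choose a preimage \<open>u\<close>, and remove the kernel part of \<open>u\<close>.\<close>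

lemma least_squares_exists:
  assumes y: "y \<in> W"
  shows "\<exists>x. least_squares y x"
proof -
  let ?K = "{k \<in> V. A k = 0}"
  obtain P where P: "W.orthogonal_projection (A ` V) P"
    using W.orthogonal_projection_exists[OF subspace_range maps] .
  obtain Q where Q: "V.orthogonal_projection ?K Q"
    using V.orthogonal_projection_exists[OF V.subspace_kernel[OF linear_A]] by blast
  obtain u where u: "u \<in> V" "P y = A u"
    using P y by (auto simp: W.orthogonal_projection_def)
  have Qu: "Q u \<in> ?K" "\<forall>k\<in>?K. ipV (u - Q u) k = 0"
    using Q u by (auto simp: V.orthogonal_projection_def)
  have "A (u - Q u) = P y" using Qu u by (simp add: linear_diff[OF linear_A])
  moreover have "\<forall>v\<in>V. ipW (y - P y) (A v) = 0"
    using P y by (auto simp: W.orthogonal_projection_def)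
  ultimately have "least_squares y (u - Q u)"
    using Qu u V.V_closed unfolding least_squares_def by auto
  then show ?thesis ..
qed

text \<open>The difference of two solutions is in the kernel, because its image is orthogonal to itself,
  and it is orthogonal to the kernel.\<close>

lemma least_squares_unique:
  assumes "least_squares y x" "least_squares y x'"
  shows "x = x'"
proof -
  let ?d = "x - x'"
  have d: "?d \<in> V" using assms V.V_closed by (auto simp: least_squares_def)
  have "ipW (A ?d) (A ?d) = ipW (y - A x') (A ?d) - ipW (y - A x) (A ?d)"
    by (simp add: linear_diff[OF linear_A] W.ip_simps)
  also have "\<dots> = 0" using assms d by (simp add: least_squares_def)
  finally have "A ?d = 0" using W.definite maps d by blast
  then have "ipV x ?d = 0" "ipV x' ?d = 0" using assms d by (auto simp: least_squares_def)
  then have "?d = 0" using V.definite[OF d] by (simp add: V.ip_simps)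
  then show ?thesis by simp
qed

lemma least_squares_add:
  assumes "least_squares y x" "least_squares z u"
  shows "least_squares (y + z) (x + u)"
proof -
  have "y + z - A (x + u) = (y - A x) + (z - A u)" by (simp add: linear_add[OF linear_A])
  then show ?thesis
    using assms V.V_closed(1) unfolding least_squares_def
    by (simp only: V.ip_simps bilinear_ladd[OF W.bilinear]) simp
qed

lemma least_squares_scale:
  assumes "least_squares y x"
  shows "least_squares (c *\<^sub>R y) (c *\<^sub>R x)"
proof -
  have "c *\<^sub>R y - A (c *\<^sub>R x) = c *\<^sub>R (y - A x)"
    by (simp add: linear_cmul[OF linear_A] scaleR_diff_right)
  then show ?thesis
    using assms V.V_closed(3) unfolding least_squares_def
    by (simp only: V.ip_simps bilinear_lmul[OF W.bilinear]) simp
qed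

text \<open>Orthogonality to the kernel comes from \<open>G y = (G A) (G y)\<close> and the symmetry of \<open>G A\<close>; the
  condition on the residual comes from the symmetry of \<open>A G\<close> and \<open>A G A = A\<close>.\<close>

lemma is_pinv_least_squares:
  assumes G: "is_pinv_on V ipV W ipW A G" and y: "y \<in> W"
  shows "least_squares y (G y)"
proof -
  have Gy: "G y \<in> V" and lin: "\<And>c z. z \<in> W \<Longrightarrow> G (c *\<^sub>R z) = c *\<^sub>R G z"
    and AGA: "\<And>v. v \<in> V \<Longrightarrow> A (G (A v)) = A v" and GAG: "G (A (G y)) = G y"
    and symW: "\<And>z. z \<in> W \<Longrightarrow> ipW (A (G y)) z = ipW y (A (G z))"
    and symV: "\<And>u v. u \<in> V \<Longrightarrow> v \<in> V \<Longrightarrow> ipV (G (A u)) v = ipV u (G (A v))"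
    using G y unfolding is_pinv_on_def by blast+
  have G0: "G 0 = 0" using lin[of 0 0] W.V_closed by simp
  have "ipV (G y) k = 0" if "k \<in> V" "A k = 0" for k
    using symV[OF Gy that(1)] GAG that(2) G0 by (simp add: V.ip_simps)
  moreover have "ipW (y - A (G y)) (A v) = 0" if "v \<in> V" for v
    using symW[of "A v"] AGA[OF that] maps that by (auto simp: W.ip_simps)
  ultimately show ?thesis using Gy unfolding least_squares_def by blast
qed

text \<open>Linearity of \<open>G\<close> follows from uniqueness, because the normal equations are linear in
  \<open>(y, x)\<close>.\<close>

lemma least_squares_is_pinv:
  assumes G: "\<And>y. y \<in> W \<Longrightarrow> least_squares y (G y)"
  shows "is_pinv_on V ipV W ipW A G"
proof -
  have inV: "G y \<in> V" if "y \<in> W" for y using G[OF that] by (simp add: least_squares_def)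
  have ker: "ipV (G y) k = 0" if "y \<in> W" "k \<in> V" "A k = 0" for y k
    using G[OF that(1)] that by (simp add: least_squares_def)
  have res: "ipW y (A v) = ipW (A (G y)) (A v)" if "y \<in> W" "v \<in> V" for y v
    using G[OF that(1)] that by (simp add: least_squares_def W.ip_simps)
  have add: "G (y + z) = G y + G z" if "y \<in> W" "z \<in> W" for y z
    by (rule least_squares_unique[OF G[OF W.V_closed(1)] least_squares_add[OF G G]])
      (fact that)+
  have scale: "G (c *\<^sub>R y) = c *\<^sub>R G y" if "y \<in> W" for c y
    by (rule least_squares_unique[OF G[OF W.V_closed(3)] least_squares_scale[OF G]])
      (fact that)+
  have AW: "A v \<in> W" if "v \<in> V" for v using maps that by blast
  have AGA: "A (G (A v)) = A v" if v: "v \<in> V" for v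
  proof -
    let ?d = "v - G (A v)"
    have d: "?d \<in> V" by (intro V.V_closed(2) v inV AW)
    have "ipW (A ?d) (A ?d) = ipW (A v) (A ?d) - ipW (A (G (A v))) (A ?d)"
      by (simp add: linear_diff[OF linear_A] W.ip_simps)
    also have "\<dots> = 0" using res[OF AW[OF v] d] by simp
    finally have "A ?d = 0" using W.definite[OF AW[OF d]] by blast
    then show ?thesis by (simp add: linear_diff[OF linear_A])
  qed
  have GAG: "G (A (G y)) = G y" if y: "y \<in> W" for y
  proof (rule least_squares_unique)
    show "least_squares (A (G y)) (G (A (G y)))" using G AW inV y by blast
    \<comment> \<open>\<open>G y\<close> is orthogonal to the kernel and reproduces \<open>A (G y)\<close> without residual.\<close>
    show "least_squares (A (G y)) (G y)"
      using inV[OF y] ker[OF y] by (simp add: least_squares_def W.ip_simps)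
  qed
  have symW: "ipW (A (G y)) z = ipW y (A (G z))" if "y \<in> W" "z \<in> W" for y z
  proof -
    have "ipW z (A (G y)) = ipW (A (G z)) (A (G y))" using res inV that by blast
    moreover have "ipW y (A (G z)) = ipW (A (G y)) (A (G z))" using res inV that by blast
    ultimately show ?thesis using W.ip_commute[of z] W.ip_commute[of "A (G z)"] by simp
  qed
  have GA: "ipV u (G (A v)) = ipV (G (A u)) (G (A v))" if u: "u \<in> V" and v: "v \<in> V" for u v
  proof -
    have "u - G (A u) \<in> V" "A (u - G (A u)) = 0"
      using u inV AW AGA V.V_closed by (auto simp: linear_diff[OF linear_A])
    then have "ipV (G (A v)) (u - G (A u)) = 0" using ker AW v by blast
    then show ?thesis by (simp add: V.ip_simps V.ip_commute[of "G (A v)"])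
  qed
  have symV: "ipV (G (A u)) v = ipV u (G (A v))" if "u \<in> V" "v \<in> V" for u v
    using GA[OF that] GA[OF that(2,1)] V.ip_commute[of v] V.ip_commute[of "G (A v)"] by simp
  show ?thesis
    unfolding is_pinv_on_def using inV add scale AGA GAG symW symV by blast
qed

lemma pinv_least_squares:
  assumes "y \<in> W"
  shows "least_squares y (pinv_on V ipV W ipW A y)"
proof -
  let ?pinv = "\<lambda>G. is_pinv_on V ipV W ipW A G \<and> (\<forall>y. y \<notin> W \<longrightarrow> G y = 0)"
  have "\<exists>!G. ?pinv G"
  proof (rule ex_ex1I)
    \<comment> \<open>The value \<open>0\<close> outside \<open>W\<close> is the one prescribed by the definition of \<open>pinv_on\<close>.\<close>
    define G where "G y = (if y \<in> W then SOME x. least_squares y x else 0)" for y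
    have "least_squares y (G y)" if "y \<in> W" for y
      unfolding G_def using that someI_ex[OF least_squares_exists] by simp
    then have "?pinv G" using least_squares_is_pinv[of G] by (simp add: G_def)
    then show "\<exists>G. ?pinv G" by (rule exI[where x = G])
    show "G = H" if "?pinv G" "?pinv H" for G H
    proof
      show "G y = H y" for y
        using that is_pinv_least_squares[of _ y] least_squares_unique[of y "G y" "H y"]
        by (cases "y \<in> W") auto
    qed
  qed
  from theI'[OF this] have "is_pinv_on V ipV W ipW A (pinv_on V ipV W ipW A)"
    unfolding pinv_on_def by blast
  then show ?thesis using is_pinv_least_squares assms by blast
qed

section \<open>The effective resistance operator is an orthogonal projection\<close>

definition resistance :: "'a \<Rightarrow> 'a"
  where "resistance = adj \<circ> pinv_on W ipW W ipW (A \<circ> adj) \<circ> A"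

text \<open>For \<open>r = x - T x\<close>, the least-squares property of the pseudoinverse of \<open>A A*\<close> makes \<open>A r\<close>
  orthogonal to the range of \<open>A A*\<close>. Testing against \<open>A A* (A r)\<close> gives \<open>A* A r = 0\<close>, so
  \<open>\<langle>A r, A r\<rangle> = \<langle>r, A* A r\<rangle> = 0\<close>. Thus \<open>A r = 0\<close>, which means that \<open>r\<close> is orthogonal to the range
  of \<open>A*\<close>.\<close>

lemma resistance_projection: "V.orthogonal_projection (adj ` W) resistance"
  unfolding V.orthogonal_projection_def
proof (intro ballI conjI)
  interpret L: inner_subspace_map W ipW W ipW "A \<circ> adj"
    by (intro inner_subspace_map.intro inner_subspace_map_axioms.intro W.inner_subspace_axioms
        linear_compose[OF linear_adj linear_A]) (use maps adj_in in auto)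
  fix x assume x: "x \<in> V"
  then have Ax: "A x \<in> W" using maps by blast
  define z where "z = pinv_on W ipW W ipW (A \<circ> adj) (A x)"
  have z: "z \<in> W" and normal: "\<And>v. v \<in> W \<Longrightarrow> ipW (A x - A (adj z)) (A (adj v)) = 0"
    using L.pinv_least_squares[OF Ax] by (auto simp: L.least_squares_def z_def)
  have T: "resistance x = adj z" by (simp add: resistance_def z_def)
  then show "resistance x \<in> adj ` W" using z by blast
  let ?r = "x - adj z"
  have r: "?r \<in> V" using x adj_in V.V_closed by blast
  then have Ar: "A ?r \<in> W" using maps by blast
  have "ipW (A ?r) (A (adj (A ?r))) = 0"
    using normal[OF Ar] by (simp add: linear_diff[OF linear_A])
  then have "ipV (adj (A ?r)) (adj (A ?r)) = 0"
    using adj_ip[OF adj_in] by simp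
  then have "adj (A ?r) = 0" using V.definite adj_in by blast
  then have "ipW (A ?r) (A ?r) = 0" using ip_adj[OF r, of "A ?r"] by (simp add: V.ip_simps)
  then have "A ?r = 0" using W.definite Ar by blast
  then show "ipV (x - resistance x) s = 0" if "s \<in> adj ` W" for s
    using that T ip_adj[OF r] by (auto simp: W.ip_simps)
qed

lemma subspace_range_adj: "subspace (adj ` W)"
  using linear_subspace_image[OF linear_adj W.subspace_V] .

lemma range_adj_subset: "adj ` W \<subseteq> V"
  using adj_in by blast

lemma resistance_eigenvalues_sum:
  "(\<Sum>\<mu>\<in>eigenvalues_on V resistance. real (multiplicity_on V resistance \<mu>) * \<mu>)
    = real (rank_on W adj)"
  unfolding rank_on_def
  by (rule V.orthogonal_projection_eigenvalues_sum[OF subspace_range_adj range_adj_subset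
        resistance_projection])

lemma resistance_trace:
  assumes "orthonormal_basis_on V ipV I \<alpha>"
  shows "(\<Sum>i\<in>I. ipV (resistance (\<alpha> i)) (\<alpha> i)) = real (rank_on W adj)"
  unfolding rank_on_def
  by (rule V.orthogonal_projection_trace[OF subspace_range_adj range_adj_subset
        resistance_projection assms])

end

section \<open>Chain spaces\<close>

lemma lookup_scaleR: "Poly_Mapping.lookup (c *\<^sub>R f) x = c *\<^sub>R Poly_Mapping.lookup f x"
proof -
  have "finite {x. c *\<^sub>R Poly_Mapping.lookup f x \<noteq> 0}"
    by (rule finite_subset[OF _ finite_keys[of f]]) (auto simp: in_keys_iff)
  then show ?thesis by (simp add: scaleR_poly_mapping_def lookup_Abs_poly_mapping)
qed

lemma chain_expansion:
  assumes "finite (simplices K p)" and "c \<in> chain_space K p"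
  shows "c = (\<Sum>\<sigma>\<in>simplices K p. Poly_Mapping.lookup c \<sigma> *\<^sub>R Poly_Mapping.single \<sigma> 1)"
proof (rule poly_mapping_eqI)
  fix \<tau>
  have "Poly_Mapping.lookup (\<Sum>\<sigma>\<in>simplices K p. Poly_Mapping.lookup c \<sigma> *\<^sub>R Poly_Mapping.single \<sigma> 1) \<tau>
      = (\<Sum>\<sigma>\<in>simplices K p. if \<sigma> = \<tau> then Poly_Mapping.lookup c \<sigma> else 0)"
    unfolding lookup_sum by (intro sum.cong) (auto simp: lookup_scaleR lookup_single)
  also have "\<dots> = Poly_Mapping.lookup c \<tau>"
    using assms by (auto simp: chain_space_def in_keys_iff)
  finally show "Poly_Mapping.lookup c \<tau> = Poly_Mapping.lookup
      (\<Sum>\<sigma>\<in>simplices K p. Poly_Mapping.lookup c \<sigma> *\<^sub>R Poly_Mapping.single \<sigma> 1) \<tau>" by simp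
qed

lemma chain_space_iff:
  "c \<in> chain_space K p \<longleftrightarrow> (\<forall>\<sigma>. \<sigma> \<notin> simplices K p \<longrightarrow> Poly_Mapping.lookup c \<sigma> = 0)"
  by (auto simp: chain_space_def in_keys_iff)

lemma subspace_chain_space: "subspace (chain_space K p)"
  by (simp add: subspace_def chain_space_iff lookup_add lookup_scaleR)

lemma chain_space_span:
  assumes "finite (simplices K p)"
  shows "span ((\<lambda>\<sigma>. Poly_Mapping.single \<sigma> 1) ` simplices K p) = chain_space K p"
proof
  show "span ((\<lambda>\<sigma>. Poly_Mapping.single \<sigma> 1) ` simplices K p) \<subseteq> chain_space K p"
    by (rule span_minimal[OF _ subspace_chain_space]) (auto simp: chain_space_def)
  show "chain_space K p \<subseteq> span ((\<lambda>\<sigma>. Poly_Mapping.single \<sigma> 1) ` simplices K p)"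
  proof
    fix c assume "c \<in> chain_space K p"
    then have "c = (\<Sum>\<sigma>\<in>simplices K p. Poly_Mapping.lookup c \<sigma> *\<^sub>R Poly_Mapping.single \<sigma> 1)"
      using chain_expansion assms by blast
    also have "\<dots> \<in> span ((\<lambda>\<sigma>. Poly_Mapping.single \<sigma> 1) ` simplices K p)"
      by (intro span_sum span_scale span_base) auto
    finally show "c \<in> span ((\<lambda>\<sigma>. Poly_Mapping.single \<sigma> 1) ` simplices K p)" .
  qed
qed

lemma finite_simplices: "finite_simplicial_complex K \<Longrightarrow> finite (simplices K p)"
  by (auto simp: finite_simplicial_complex_def simplices_def)

lemma chain_inner_subspace:
  fixes K :: "'v set set"
  assumes K: "finite_simplicial_complex K" and w: "\<forall>\<sigma>\<in>K. w \<sigma> > 0"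
  shows "inner_subspace (chain_space K p) (chain_inner K w p)"
proof
  have pos: "w \<sigma> > 0" if "\<sigma> \<in> simplices K p" for \<sigma> using that w by (auto simp: simplices_def)
  have fin: "finite (simplices K p)" using finite_simplices[OF K] .
  show "subspace (chain_space K p)" by (rule subspace_chain_space)
  show "\<exists>B. finite B \<and> chain_space K p \<subseteq> span B"
    using chain_space_span[OF fin] fin by (metis finite_imageI order_refl)
  show "bilinear (chain_inner K w p)"
    unfolding bilinear_def chain_inner_def
    by (auto intro!: linearI
        simp: lookup_add lookup_scaleR algebra_simps sum.distrib sum_distrib_left)
  show "chain_inner K w p x y = chain_inner K w p y x" for x y
    by (simp add: chain_inner_def mult.commute)
  have nonneg: "0 \<le> Poly_Mapping.lookup x \<sigma> * Poly_Mapping.lookup x \<sigma> * inverse (w \<sigma>)"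
    if "\<sigma> \<in> simplices K p" for x :: "'v chain" and \<sigma>
    using pos[OF that] by simp
  then show "0 \<le> chain_inner K w p x x" for x
    unfolding chain_inner_def by (rule sum_nonneg)
  show "x = 0" if x: "x \<in> chain_space K p" and eq: "chain_inner K w p x x = 0" for x
  proof (rule poly_mapping_eqI)
    have "\<forall>\<sigma>\<in>simplices K p.
        Poly_Mapping.lookup x \<sigma> * Poly_Mapping.lookup x \<sigma> * inverse (w \<sigma>) = 0"
      using eq nonneg unfolding chain_inner_def by (subst (asm) sum_nonneg_eq_0_iff[OF fin]) auto
    then have "\<forall>\<sigma>\<in>simplices K p. Poly_Mapping.lookup x \<sigma> = 0" using pos by force
    then show "Poly_Mapping.lookup x \<tau> = Poly_Mapping.lookup 0 \<tau>" for \<tau>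
      using x by (auto simp: chain_space_def in_keys_iff)
  qed
qed

text \<open>The dimension does not depend on the weights. For constant weight \<open>1\<close> the simplices are an
  orthonormal basis.\<close>

lemma dim_chain_space:
  fixes K :: "'v set set"
  assumes "finite_simplicial_complex K"
  shows "dim (chain_space K p) = card (simplices K p)"
proof -
  interpret inner_subspace "chain_space K p" "chain_inner K (\<lambda>_. 1) p"
    using assms by (rule chain_inner_subspace) simp
  let ?e = "\<lambda>\<sigma>. Poly_Mapping.single \<sigma> (1::real)"
  have fin: "finite (simplices K p)" using finite_simplices[OF assms] .
  have "chain_inner K (\<lambda>_. 1) p (?e \<sigma>) (?e \<tau>) = (if \<sigma> = \<tau> then 1 else 0)"
    if "\<sigma> \<in> simplices K p" for \<sigma> \<tau>
  proof -
    have "chain_inner K (\<lambda>_. 1) p (?e \<sigma>) (?e \<tau>)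
        = (\<Sum>\<rho>\<in>simplices K p. if \<rho> = \<sigma> then if \<sigma> = \<tau> then 1 else 0 else 0)"
      unfolding chain_inner_def by (intro sum.cong) (auto simp: lookup_single)
    then show ?thesis using fin that by simp
  qed
  moreover have "?e \<sigma> \<in> chain_space K p" if "\<sigma> \<in> simplices K p" for \<sigma>
    using that by (simp add: chain_space_def)
  ultimately have "orthonormal_basis_on (chain_space K p) (chain_inner K (\<lambda>_. 1) p) (simplices K p) ?e"
    unfolding orthonormal_basis_on_def using chain_space_span[OF fin] by simp
  from orthonormal_basis_card[OF this] show ?thesis by simp
qed

lemma face_in_complex:
  assumes "finite_simplicial_complex K" "\<sigma> \<in> K" "\<tau> \<subseteq> \<sigma>" "\<tau> \<noteq> {}"
  shows "\<tau> \<in> K"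
proof -
  have "\<forall>\<sigma>\<in>K. \<forall>\<tau>. \<tau> \<subseteq> \<sigma> \<and> \<tau> \<noteq> {} \<longrightarrow> \<tau> \<in> K"
    using assms(1) unfolding finite_simplicial_complex_def by (elim conjE)
  from bspec[OF this assms(2)] have "\<tau> \<subseteq> \<sigma> \<and> \<tau> \<noteq> {} \<longrightarrow> \<tau> \<in> K" by (rule spec)
  from mp[OF this conjI[OF assms(3,4)]] show ?thesis .
qed

text \<open>For \<open>p > 0\<close> a facet of a \<open>p\<close>-simplex is nonempty and therefore a simplex. For \<open>p = 0\<close> this
  fails, and there the boundary map is zero instead.\<close>

lemma simplex_boundary_in_chain_space:
  assumes K: "finite_simplicial_complex K" and \<sigma>: "\<sigma> \<in> simplices K p" and p: "p > 0"
  shows "simplex_boundary \<sigma> \<in> chain_space K (p - 1)"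
  unfolding simplex_boundary_def
proof (rule subspace_sum[OF subspace_chain_space])
  fix i assume "i \<in> {..<card \<sigma>}"
  have fin: "finite \<sigma>" and \<sigma>K: "\<sigma> \<in> K" and card: "int (card \<sigma>) = p + 1"
    using K \<sigma> by (auto simp: finite_simplicial_complex_def simplices_def)
  define v where "v = sorted_list_of_set \<sigma> ! i"
  have "v \<in> \<sigma>"
    using \<open>i \<in> {..<card \<sigma>}\<close> fin unfolding v_def
    by (metis lessThan_iff length_sorted_list_of_set nth_mem set_sorted_list_of_set)
  then have face: "int (card (\<sigma> - {v})) = p"
    using card card_Suc_Diff1[OF fin] by fastforce
  then have "card (\<sigma> - {v}) \<noteq> 0" using p by linarith
  then have "\<sigma> - {v} \<noteq> {}" by (intro notI) (simp only: card.empty)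
  with K \<sigma>K Diff_subset have "\<sigma> - {v} \<in> K" by (rule face_in_complex)
  then have "\<sigma> - {v} \<in> simplices K (p - 1)" using face by (simp add: simplices_def)
  then show "Poly_Mapping.single (\<sigma> - {v}) ((- 1) ^ i) \<in> chain_space K (p - 1)"
    by (simp add: chain_space_def)
qed

lemma boundary_inner_subspace_map:
  assumes K: "finite_simplicial_complex K" and w: "\<forall>\<sigma>\<in>K. w \<sigma> > 0"
  shows "inner_subspace_map (chain_space K p) (chain_inner K w p)
    (chain_space K (p - 1)) (chain_inner K w (p - 1)) (boundary_map K p)"
proof (intro inner_subspace_map.intro inner_subspace_map_axioms.intro chain_inner_subspace assms)
  show "linear (boundary_map K p)"
    by (rule linearI)
      (simp_all add: boundary_map_def lookup_add lookup_scaleR scaleR_add_left sum.distrib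
        scaleR_sum_right)
  show "boundary_map K p ` chain_space K p \<subseteq> chain_space K (p - 1)"
    using simplex_boundary_in_chain_space[OF K]
    by (auto simp: boundary_map_def subspace_0[OF subspace_chain_space]
        intro!: subspace_sum[OF subspace_chain_space] subspace_scale[OF subspace_chain_space])
qed

theorem theorem8p2:
  fixes K :: "'v::linorder set set" and w :: "'v set \<Rightarrow> real" and p :: int
  assumes "finite_simplicial_complex K"
    and "\<forall>\<sigma>\<in>K. w \<sigma> > 0"
    and "p \<ge> 0"
  shows
    "((\<Sum>\<mu>\<in>eigenvalues_on (chain_space K p) (effective_resistance K w p).
          real (multiplicity_on (chain_space K p) (effective_resistance K w p) \<mu>) * \<mu>)
        = real (rank_on (chain_space K (p - 1)) (boundary_adj K w p))
      \<and> real (rank_on (chain_space K (p - 1)) (boundary_adj K w p))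
        = real (card (simplices K (p - 1))) - real (null_on (chain_space K (p - 1)) (boundary_adj K w p)))
    \<and> (\<forall>(I :: 'i set) \<alpha>.
        orthonormal_basis_on (chain_space K p) (chain_inner K w p) I \<alpha> \<longrightarrow>
          (\<Sum>i\<in>I. chain_inner K w p (effective_resistance K w p (\<alpha> i)) (\<alpha> i))
            = real (rank_on (chain_space K (p - 1)) (boundary_adj K w p))
        \<and> real (rank_on (chain_space K (p - 1)) (boundary_adj K w p))
            = real (card (simplices K (p - 1))) - real (null_on (chain_space K (p - 1)) (boundary_adj K w p)))"
proof -
  interpret inner_subspace_map "chain_space K p" "chain_inner K w p"
    "chain_space K (p - 1)" "chain_inner K w (p - 1)" "boundary_map K p"
    using assms(1,2) by (rule boundary_inner_subspace_map)
  have adj_eq: "adj = boundary_adj K w p" by (simp add: boundary_adj_def)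
  have res_eq: "resistance = effective_resistance K w p"
    by (simp add: resistance_def effective_resistance_def up_laplacian_def adj_eq)
  have "rank_on (chain_space K (p - 1)) adj + null_on (chain_space K (p - 1)) adj
      = card (simplices K (p - 1))"
    using W.rank_nullity[OF linear_adj] dim_chain_space[OF assms(1)] by simp
  then have rank: "real (rank_on (chain_space K (p - 1)) (boundary_adj K w p))
      = real (card (simplices K (p - 1))) - real (null_on (chain_space K (p - 1)) (boundary_adj K w p))"
    unfolding adj_eq by linarith
  show ?thesis
    using rank resistance_eigenvalues_sum resistance_trace unfolding adj_eq res_eq by blast
qed

end
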